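(* Consider the weakly convex game with $0<\eta<\min_i\rho_i^{-1}$ and $\mu>0$, and assume (C1): for every $i$, every $x_i\in X_i$ and all $y,w\in X$, $\|\nabla_{x_i}\hat f_i^\eta(x_i,y)-\nabla_{x_i}\hat f_i^\eta(x_i,w)\|\le\hat L_i\|y_i-w_i\|+\hat L_{-i}\|y_{-i}-w_{-i}\|$; and (C2): the spectral norm of $\Gamma_2$ is $<1$. Then: (i) for all $y,w\in X$, $(\|\hat x^\eta_i(y)-\hat x^\eta_i(w)\|)_{i=1}^N\le\Gamma_2(\|y_i-w_i\|)_{i=1}^N$ componentwise, so $\hat x^\eta:X\to X$ is a contraction (w.r.t. $\|x\|_*=\|(\|x_1\|,\dots,\|x_N\|)\|_2$) with a unique fixed point $x^*$; (ii) $x^*$ is the unique QNE of the Moreau-smoothed game over $X$, i.e. the unique $x\in X$ with $\nabla_{x_i}f_i^\eta(x)^\top(z_i-x_i)\ge0$ for all $z_i\in X_i$ and all $i$; if in addition each $X_i$ is compact and each $\partial_{x_i}f_i(\cdot,x_{-i})$ is $L_i$-Lipschitz, then $x^*$ is an $\eta LDM^*$-QNE of the original game, with $L=\max_iL_i$, $D=\max_i\operatorname{diam}(X_i)$, $M^*=\max_i\|\nabla_{x_i}f_i^\eta(x^* )\|$; (iii) if $\varepsilon_i^k\ge0$ with $\sum_k\varepsilon_i^k<\infty$ for all $i$, the MS-SSBR iterates satisfy $x^k\to x^*$ almost surely.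
   Context: $N$-player game: player $i$ has nonempty closed convex $X_i\subseteq\mathbb{R}^{n_i}$ and real-valued $f_i$ with $f_i(\cdot,x_{-i})$ $\rho_i$-weakly convex ($f_i+\frac{\rho_i}2\|\cdot\|^2$ convex) for each $x_{-i}$; $X=\prod_iX_i$. Moreau envelope $f_i^\eta(x_i,x_{-i})=\min_y\{f_i(y,x_{-i})+\frac1{2\eta}\|y-x_i\|^2\}$. Quadratic surrogate near $y\in X$: $\hat f_i^\eta(z,y)\triangleq f_i^\eta(y)+\nabla_{x_i}f_i^\eta(y)^\top(z-y_i)+\frac\mu2\|z-y_i\|^2$. Best response $\hat x_i^\eta(x)\triangleq\operatorname*{argmin}_{z\in X_i}\hat f_i^\eta(z,x)$. $\Gamma_2\in\mathbb{R}^{N\times N}$: $(\Gamma_2)_{ii}=\hat L_i/\mu$, $(\Gamma_2)_{ij}=\hat L_{-i}/\mu$ for $j\ne i$. QNE / $\epsilon$-QNE of the original game: $x\in X$ with $f_i'(x_i,x_{-i};z_i-x_i)\ge-\epsilon$ for all $z_i\in X_i$, all $i$ ($\epsilon=0$ for QNE), $f_i'$ the directional derivative in $x_i$. Subdifferential of a $\rho$-weakly convex $g$: $\partial(g+\frac\rho2\|\cdot\|^2)-\rho x$; a set-valued $F$ is $L$-Lipschitz if $F(u)\subseteq F(v)+L\|u-v\|\mathbb{B}$. MS-SSBR: $x^0\in X$; at iteration $k$ each player $i$ produces random $x_i^{k+1}\in X_i$ with $\mathbb{E}[\|x_i^{k+1}-\hat x_i^\eta(x^k)\|^2\mid x^k]\le(\varepsilon_i^k)^2$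 a.s. *)

theory Defs
  imports "HOL-Analysis.Analysis" "HOL-Probability.Probability"
begin

(* Players are indexed by a finite type 'p (N = CARD('p)).  All players' strategy
   spaces live in one Euclidean space 'v; player i's own space R^{n_i} is modelled
   by a linear subspace S i of 'v (isometric to R^{dim (S i)}).  A strategy profile
   is a map x :: 'p \<Rightarrow> 'v with x i \<in> S i. *)

definition profiles :: "('p \<Rightarrow> 'v set) \<Rightarrow> ('p \<Rightarrow> 'v) set" where
  "profiles X = {x. \<forall>i. x i \<in> X i}"

definition weakly_convex_on :: "real \<Rightarrow> 'v::real_normed_vector set \<Rightarrow> ('v \<Rightarrow> real) \<Rightarrow> bool" where
  "weakly_convex_on \<rho> S g \<longleftrightarrow> convex_on S (\<lambda>u. g u + \<rho> / 2 * (norm u)\<^sup>2)"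

definition moreau_env :: "real \<Rightarrow> 'v::real_normed_vector set \<Rightarrow> ('v \<Rightarrow> real) \<Rightarrow> 'v \<Rightarrow> real" where
  "moreau_env \<eta> S g u = Inf ((\<lambda>y. g y + 1 / (2 * \<eta>) * (norm (y - u))\<^sup>2) ` S)"

definition grad_on :: "'v::euclidean_space set \<Rightarrow> ('v \<Rightarrow> real) \<Rightarrow> 'v \<Rightarrow> 'v" where
  "grad_on S g u = (THE v. v \<in> S \<and> (g has_derivative (\<lambda>h. v \<bullet> h)) (at u within S))"

definition pgrad :: "('p \<Rightarrow> 'v::euclidean_space set) \<Rightarrow> (('p \<Rightarrow> 'v) \<Rightarrow> real) \<Rightarrow> 'p \<Rightarrow> ('p \<Rightarrow> 'v) \<Rightarrow> 'v" where
  "pgrad S g i x = grad_on (S i) (\<lambda>z. g (x(i := z))) (x i)"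

definition fenv :: "('p \<Rightarrow> 'v::euclidean_space set) \<Rightarrow> ('p \<Rightarrow> ('p \<Rightarrow> 'v) \<Rightarrow> real) \<Rightarrow> real \<Rightarrow> 'p \<Rightarrow> ('p \<Rightarrow> 'v) \<Rightarrow> real" where
  "fenv S f \<eta> i x = moreau_env \<eta> (S i) (\<lambda>y. f i (x(i := y))) (x i)"

definition fhat :: "('p \<Rightarrow> 'v::euclidean_space set) \<Rightarrow> ('p \<Rightarrow> ('p \<Rightarrow> 'v) \<Rightarrow> real) \<Rightarrow> real \<Rightarrow> real \<Rightarrow> 'p \<Rightarrow> 'v \<Rightarrow> ('p \<Rightarrow> 'v) \<Rightarrow> real" where
  "fhat S f \<eta> \<mu> i z y = fenv S f \<eta> i y + pgrad S (fenv S f \<eta> i) i y \<bullet> (z - y i) + \<mu> / 2 * (norm (z - y i))\<^sup>2"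

definition bresp :: "('p \<Rightarrow> 'v::euclidean_space set) \<Rightarrow> ('p \<Rightarrow> 'v set) \<Rightarrow> ('p \<Rightarrow> ('p \<Rightarrow> 'v) \<Rightarrow> real) \<Rightarrow> real \<Rightarrow> real \<Rightarrow> 'p \<Rightarrow> ('p \<Rightarrow> 'v) \<Rightarrow> 'v" where
  "bresp S X f \<eta> \<mu> i x = (THE z. z \<in> X i \<and> (\<forall>w \<in> X i. fhat S f \<eta> \<mu> i z x \<le> fhat S f \<eta> \<mu> i w x))"

definition Gamma2 :: "('p::finite \<Rightarrow> real) \<Rightarrow> ('p \<Rightarrow> real) \<Rightarrow> real \<Rightarrow> real^'p^'p" where
  "Gamma2 Lh Lm \<mu> = (\<chi> i j. if i = j then Lh i / \<mu> else Lm i / \<mu>)"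

definition spectral_norm :: "real^'n^'m \<Rightarrow> real" where
  "spectral_norm A = onorm (\<lambda>v. A *v v)"

definition norm_star :: "('p::finite \<Rightarrow> 'v::real_normed_vector) \<Rightarrow> real" where
  "norm_star x = sqrt (\<Sum>j\<in>UNIV. (norm (x j))\<^sup>2)"

definition norm_minus :: "'p::finite \<Rightarrow> ('p \<Rightarrow> 'v::real_normed_vector) \<Rightarrow> real" where
  "norm_minus i x = sqrt (\<Sum>j\<in>UNIV - {i}. (norm (x j))\<^sup>2)"

definition smoothed_QNE :: "('p \<Rightarrow> 'v::euclidean_space set) \<Rightarrow> ('p \<Rightarrow> 'v set) \<Rightarrow> ('p \<Rightarrow> ('p \<Rightarrow> 'v) \<Rightarrow> real) \<Rightarrow> real \<Rightarrow> ('p \<Rightarrow> 'v) \<Rightarrow> bool" where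
  "smoothed_QNE S X f \<eta> x \<longleftrightarrow> x \<in> profiles X \<and>
     (\<forall>i. \<forall>z \<in> X i. pgrad S (fenv S f \<eta> i) i x \<bullet> (z - x i) \<ge> 0)"

definition eps_QNE :: "('p \<Rightarrow> 'v set) \<Rightarrow> ('p \<Rightarrow> ('p \<Rightarrow> 'v::real_normed_vector) \<Rightarrow> real) \<Rightarrow> real \<Rightarrow> ('p \<Rightarrow> 'v) \<Rightarrow> bool" where
  "eps_QNE X f \<epsilon> x \<longleftrightarrow> x \<in> profiles X \<and>
     (\<forall>i. \<forall>z \<in> X i. \<exists>l. ((\<lambda>t. (f i (x(i := x i + t *\<^sub>R (z - x i))) - f i x) / t) \<longlongrightarrow> l) (at_right 0)
                         \<and> l \<ge> - \<epsilon>)"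

definition convex_subdiff :: "'v::euclidean_space set \<Rightarrow> ('v \<Rightarrow> real) \<Rightarrow> 'v \<Rightarrow> 'v set" where
  "convex_subdiff S h u = {v \<in> S. \<forall>y \<in> S. h y \<ge> h u + v \<bullet> (y - u)}"

definition wc_subdiff :: "real \<Rightarrow> 'v::euclidean_space set \<Rightarrow> ('v \<Rightarrow> real) \<Rightarrow> 'v \<Rightarrow> 'v set" where
  "wc_subdiff \<rho> S g u = (\<lambda>v. v - \<rho> *\<^sub>R u) ` convex_subdiff S (\<lambda>y. g y + \<rho> / 2 * (norm y)\<^sup>2) u"

definition setval_lipschitz_on :: "'v::real_normed_vector set \<Rightarrow> real \<Rightarrow> ('v \<Rightarrow> 'w::real_normed_vector set) \<Rightarrow> bool" where
  "setval_lipschitz_on S L F \<longleftrightarrow>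
     (\<forall>u \<in> S. \<forall>v \<in> S. \<forall>a \<in> F u. \<exists>b \<in> F v. norm (a - b) \<le> L * norm (u - v))"

definition ms_ssbr :: "'w measure \<Rightarrow> ('p \<Rightarrow> 'v::euclidean_space set) \<Rightarrow> ('p \<Rightarrow> 'v set) \<Rightarrow> ('p \<Rightarrow> ('p \<Rightarrow> 'v) \<Rightarrow> real) \<Rightarrow> real \<Rightarrow> real \<Rightarrow> ('p \<Rightarrow> nat \<Rightarrow> real) \<Rightarrow> (nat \<Rightarrow> 'w \<Rightarrow> ('p \<Rightarrow> 'v)) \<Rightarrow> bool" where
  "ms_ssbr M S X f \<eta> \<mu> \<epsilon> xk \<longleftrightarrow>
     (\<forall>k. xk k \<in> measurable M borel) \<and>
     (\<forall>k. \<forall>\<omega> \<in> space M. xk k \<omega> \<in> profiles X) \<and>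
     (\<forall>k i. AE \<omega> in M.
        nn_cond_exp M (vimage_algebra (space M) (xk k) borel)
          (\<lambda>\<omega>. ennreal ((norm (xk (Suc k) \<omega> i - bresp S X f \<eta> \<mu> i (xk k \<omega>)))\<^sup>2)) \<omega>
        \<le> ennreal ((\<epsilon> i k)\<^sup>2))"

end

theory Submission
  imports Defs
begin

text \<open>
  A function is \<open>c\<close>-strongly convex iff it is \<open>(-c)\<close>-weakly convex, so for \<open>\<eta> \<rho> < 1\<close> the proximal
  objective is strongly convex. Its minimizer \<open>P u\<close> is therefore unique and Lipschitz in \<open>u\<close>, the
  Moreau envelope is differentiable with gradient \<open>(u - P u) / \<eta>\<close>, and this gradient is a
  subgradient of the original function at \<open>P u\<close>. The best response is the projection of
  \<open>y\<^sub>i - \<nabla>\<^sub>i f\<^sub>i\<^sup>\<eta>(y) / \<mu>\<close> onto \<open>X\<^sub>i\<close>. Projections are nonexpansive, which with the Lipschitz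
  hypothesis gives the componentwise bound by \<open>\<Gamma>\<^sub>2\<close> and hence the contraction, and
  the variational inequality of the projection says that the fixed points are the smoothed equilibria.
  The subgradient at \<open>P u\<close> can be moved to \<open>u\<close> at cost \<open>L \<eta> \<parallel>\<nabla>f\<^sup>\<eta>(u)\<parallel>\<close>, which bounds the
  directional derivatives of the original game. For the random iterates, the squared errors have
  summable expectations, so the errors tend to \<open>0\<close> almost surely, and a contraction with
  vanishing perturbations converges.
\<close>

section \<open>Weakly convex functions\<close>

lemma convex_on_subspace_imp_continuous_on:
  fixes h :: "'v::euclidean_space \<Rightarrow> real"
  assumes S: "subspace S" and h: "convex_on S h"
  shows "continuous_on S h"
proof -
  obtain P where P: "range P \<subseteq> S" "linear P" "\<And>v. v \<in> S \<Longrightarrow> P v = v"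
    using linear_exists_left_inverse_on[OF linear_id S inj_on_id] by auto
  have "convex_on UNIV (\<lambda>x. h (P x))"
  proof (rule convex_onI)
    fix t :: real and x y
    assume "0 < t" "t < 1"
    then show "h (P ((1 - t) *\<^sub>R x + t *\<^sub>R y)) \<le> (1 - t) * h (P x) + t * h (P y)"
      using convex_onD[OF h, of t "P x" "P y"] P(1)
      by (simp add: linear_add[OF P(2)] linear_cmul[OF P(2)] image_subset_iff)
  qed auto
  then have "continuous_on S (\<lambda>x. h (P x))"
    using convex_on_continuous[OF open_UNIV] continuous_on_subset by blast
  then show ?thesis
    by (rule continuous_on_eq) (simp add: P(3))
qed

lemma weakly_convex_on_subspace_imp_continuous_on:
  fixes g :: "'v::euclidean_space \<Rightarrow> real"
  assumes S: "subspace S" and g: "weakly_convex_on \<rho> S g"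
  shows "continuous_on S g"
proof -
  have "continuous_on S (\<lambda>u. (g u + \<rho> / 2 * (norm u)\<^sup>2) - \<rho> / 2 * (norm u)\<^sup>2)"
    by (rule continuous_on_diff[OF convex_on_subspace_imp_continuous_on[OF S g[unfolded weakly_convex_on_def]]])
      (intro continuous_intros)
  then show ?thesis by simp
qed

lemma weakly_convex_on_imp_convex: "weakly_convex_on \<rho> S g \<Longrightarrow> convex S"
  unfolding weakly_convex_on_def by (rule convex_on_imp_convex)

lemma weakly_convex_onD:
  fixes g :: "'v::real_inner \<Rightarrow> real"
  assumes g: "weakly_convex_on \<rho> S g" and xy: "x \<in> S" "y \<in> S" and t: "0 \<le> t" "t \<le> 1"
  shows "g ((1 - t) *\<^sub>R x + t *\<^sub>R y)
    \<le> (1 - t) * g x + t * g y + \<rho> / 2 * (t * (1 - t) * (norm (y - x))\<^sup>2)"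
proof -
  define z where "z = (1 - t) *\<^sub>R x + t *\<^sub>R y"
  have norm_z: "(norm z)\<^sup>2 = (1 - t) * (norm x)\<^sup>2 + t * (norm y)\<^sup>2 - t * (1 - t) * (norm (y - x))\<^sup>2"
    unfolding z_def power2_norm_eq_inner by (simp add: inner_simps algebra_simps inner_commute)
  have "g z + \<rho> / 2 * (norm z)\<^sup>2
      \<le> (1 - t) * (g x + \<rho> / 2 * (norm x)\<^sup>2) + t * (g y + \<rho> / 2 * (norm y)\<^sup>2)"
    unfolding z_def by (rule convex_onD[OF g[unfolded weakly_convex_on_def] t xy])
  also have "\<dots> = (1 - t) * g x + t * g y + \<rho> / 2 * (t * (1 - t) * (norm (y - x))\<^sup>2) + \<rho> / 2 * (norm z)\<^sup>2"
    unfolding norm_z by (simp add: field_simps)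
  finally show ?thesis
    by (simp add: z_def)
qed

lemma weakly_convex_on_add_quadratic:
  fixes g :: "'v::real_inner \<Rightarrow> real"
  assumes g: "weakly_convex_on \<rho> S g"
  shows "weakly_convex_on (\<rho> - c) S (\<lambda>y. g y + c / 2 * (norm (y - u))\<^sup>2)"
proof -
  have "convex_on S (\<lambda>y. c / 2 * (norm u)\<^sup>2 - c * (u \<bullet> y))"
    using weakly_convex_on_imp_convex[OF g]
    by (intro convex_onI) (auto simp: inner_simps field_simps)
  then have "convex_on S (\<lambda>y. (g y + \<rho> / 2 * (norm y)\<^sup>2) + (c / 2 * (norm u)\<^sup>2 - c * (u \<bullet> y)))"
    by (rule convex_on_add[OF g[unfolded weakly_convex_on_def]])
  moreover have "(g y + \<rho> / 2 * (norm y)\<^sup>2) + (c / 2 * (norm u)\<^sup>2 - c * (u \<bullet> y))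
      = g y + c / 2 * (norm (y - u))\<^sup>2 + (\<rho> - c) / 2 * (norm y)\<^sup>2" for y
    unfolding power2_norm_eq_inner by (simp add: inner_simps field_simps inner_commute)
  ultimately show ?thesis
    unfolding weakly_convex_on_def by (simp only:)
qed

lemma wc_subdiff_iff:
  "v \<in> wc_subdiff \<rho> S g u \<longleftrightarrow>
    v + \<rho> *\<^sub>R u \<in> S \<and> (\<forall>y\<in>S. g u + v \<bullet> (y - u) - \<rho> / 2 * (norm (y - u))\<^sup>2 \<le> g y)"
proof -
  have "g y + \<rho> / 2 * (norm y)\<^sup>2 - (g u + \<rho> / 2 * (norm u)\<^sup>2 + (v + \<rho> *\<^sub>R u) \<bullet> (y - u))
      = g y - (g u + v \<bullet> (y - u) - \<rho> / 2 * (norm (y - u))\<^sup>2)" for y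
    unfolding power2_norm_eq_inner by (simp add: inner_simps field_simps inner_commute)
  then have "g u + \<rho> / 2 * (norm u)\<^sup>2 + (v + \<rho> *\<^sub>R u) \<bullet> (y - u) \<le> g y + \<rho> / 2 * (norm y)\<^sup>2 \<longleftrightarrow>
      g u + v \<bullet> (y - u) - \<rho> / 2 * (norm (y - u))\<^sup>2 \<le> g y" for y
    by (metis diff_ge_0_iff_ge)
  moreover have "v \<in> wc_subdiff \<rho> S g u \<longleftrightarrow>
      v + \<rho> *\<^sub>R u \<in> convex_subdiff S (\<lambda>y. g y + \<rho> / 2 * (norm y)\<^sup>2) u"
    unfolding wc_subdiff_def by (auto simp: image_iff intro: bexI[of _ "v + \<rho> *\<^sub>R u"])
  ultimately show ?thesis
    by (simp add: convex_subdiff_def)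
qed

lemma tendsto_at_right_Inf_mono_on:
  fixes q :: "'a::linorder_topology \<Rightarrow> 'b::{linorder_topology, conditionally_complete_linorder}"
  assumes ab: "a < b" and mono: "mono_on {a<..b} q" and bdd: "bdd_below (q ` {a<..b})"
  shows "(q \<longlongrightarrow> Inf (q ` {a<..b})) (at_right a)"
proof (rule order_tendstoI)
  fix y assume y: "y < Inf (q ` {a<..b})"
  have "y < q t" if "a < t" "t < b" for t
    using y cInf_lower[OF _ bdd, of "q t"] that by (auto intro: less_le_trans)
  then show "eventually (\<lambda>t. y < q t) (at_right a)"
    using ab by (auto simp: eventually_at_right[OF ab])
next
  fix y assume "Inf (q ` {a<..b}) < y"
  then obtain s where s: "a < s" "s \<le> b" "q s < y"
    using cInf_lessD[of "q ` {a<..b}" y] ab by auto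
  then have "q t < y" if "a < t" "t < s" for t
    using le_less_trans[OF mono_onD[OF mono, of t s] s(3)] s that by auto
  then show "eventually (\<lambda>t. q t < y) (at_right a)"
    using s(1) by (auto simp: eventually_at_right[OF s(1)])
qed

lemma convex_ray_mem:
  assumes "convex S" "u \<in> S" "u + d \<in> S" "0 \<le> t" "t \<le> 1"
  shows "u + t *\<^sub>R d \<in> S"
  using convexD_alt[OF assms] by (simp add: algebra_simps)

lemma weakly_convex_difference_quotient_mono_on:
  fixes g :: "'v::real_inner \<Rightarrow> real"
  assumes g: "weakly_convex_on \<rho> S g" and u: "u \<in> S" and ud: "u + d \<in> S"
  shows "mono_on {0<..1} (\<lambda>t. (g (u + t *\<^sub>R d) - g u) / t + \<rho> / 2 * t * (norm d)\<^sup>2)"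
proof (rule mono_onI)
  let ?q = "\<lambda>t. (g (u + t *\<^sub>R d) - g u) / t + \<rho> / 2 * t * (norm d)\<^sup>2"
  fix s t :: real assume st: "s \<in> {0<..1}" "t \<in> {0<..1}" "s \<le> t"
  have ray: "u + t *\<^sub>R d \<in> S"
    using st by (intro convex_ray_mem[OF weakly_convex_on_imp_convex[OF g] u ud]) auto
  have "u + s *\<^sub>R d = (1 - s / t) *\<^sub>R u + (s / t) *\<^sub>R (u + t *\<^sub>R d)"
    using st by (simp add: algebra_simps)
  then have "g (u + s *\<^sub>R d) \<le> (1 - s / t) * g u + s / t * g (u + t *\<^sub>R d)
      + \<rho> / 2 * (s / t * (1 - s / t) * (t * norm d)\<^sup>2)"
    using weakly_convex_onD[OF g u ray, of "s / t"] st by simp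
  also have "\<dots> = g u + (?q t - \<rho> / 2 * s * (norm d)\<^sup>2) * s"
    using st by (simp add: field_simps power2_eq_square)
  finally have "(g (u + s *\<^sub>R d) - g u) / s \<le> ?q t - \<rho> / 2 * s * (norm d)\<^sup>2"
    using st by (simp add: pos_divide_le_eq)
  then show "?q s \<le> ?q t"
    by linarith
qed

lemma weakly_convex_directional_derivative:
  fixes g :: "'v::euclidean_space \<Rightarrow> real"
  assumes g: "weakly_convex_on \<rho> S g" and u: "u \<in> S" and ud: "u + d \<in> S"
    and b: "b \<in> wc_subdiff \<rho> S g u"
  obtains l where "((\<lambda>t. (g (u + t *\<^sub>R d) - g u) / t) \<longlongrightarrow> l) (at_right 0)" "b \<bullet> d \<le> l"
proof -
  define q where "q t = (g (u + t *\<^sub>R d) - g u) / t + \<rho> / 2 * t * (norm d)\<^sup>2" for t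
  have lower: "b \<bullet> d \<le> q t" if t: "t \<in> {0<..1}" for t
  proof -
    have "u + t *\<^sub>R d \<in> S"
      using t by (intro convex_ray_mem[OF weakly_convex_on_imp_convex[OF g] u ud]) auto
    then have "g u + t * (b \<bullet> d) - \<rho> / 2 * (t * norm d)\<^sup>2 \<le> g (u + t *\<^sub>R d)"
      using b t by (force simp: wc_subdiff_iff)
    then show ?thesis
      using t by (simp add: q_def field_simps power2_eq_square)
  qed
  have "mono_on {0<..1} q"
    unfolding q_def by (rule weakly_convex_difference_quotient_mono_on[OF g u ud])
  then have "(q \<longlongrightarrow> Inf (q ` {0<..1})) (at_right 0)"
    using lower by (intro tendsto_at_right_Inf_mono_on) (auto intro!: bdd_belowI[of _ "b \<bullet> d"])
  then have "((\<lambda>t. q t - \<rho> / 2 * t * (norm d)\<^sup>2)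
      \<longlongrightarrow> Inf (q ` {0<..1}) - \<rho> / 2 * 0 * (norm d)\<^sup>2) (at_right 0)"
    by (intro tendsto_intros)
  then have "((\<lambda>t. (g (u + t *\<^sub>R d) - g u) / t) \<longlongrightarrow> Inf (q ` {0<..1})) (at_right 0)"
    by (simp add: q_def)
  moreover have "b \<bullet> d \<le> Inf (q ` {0<..1})"
    using lower by (intro cInf_greatest) auto
  ultimately show thesis by (rule that)
qed

section \<open>Minimizers of strongly convex functions\<close>

lemma continuous_attains_inf_coercive:
  fixes F :: "'v::heine_borel \<Rightarrow> real"
  assumes S: "closed S" and a: "a \<in> S" and F: "continuous_on S F"
    and coercive: "\<And>y. y \<in> S \<Longrightarrow> R < dist a y \<Longrightarrow> F a \<le> F y"
  obtains p where "p \<in> S" "\<And>y. y \<in> S \<Longrightarrow> F p \<le> F y"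
proof (cases "0 \<le> R")
  case True
  have "compact (cball a R \<inter> S)" "a \<in> cball a R \<inter> S"
    using S a True by (auto intro: compact_Int_closed)
  then obtain p where p: "p \<in> cball a R \<inter> S" "\<And>y. y \<in> cball a R \<inter> S \<Longrightarrow> F p \<le> F y"
    using continuous_attains_inf[of "cball a R \<inter> S" F] continuous_on_subset[OF F] by blast
  have "F p \<le> F y" if "y \<in> S" for y
    using p(2)[of a] p(2)[of y] coercive[of y] a that True by (cases "dist a y \<le> R") auto
  with p(1) that show thesis by blast
next
  case False
  with that[OF a] coercive show thesis by (meson less_le_trans not_le zero_le_dist)
qed

lemma strongly_convex_ge_if_far:
  fixes F :: "'v::real_inner \<Rightarrow> real"
  assumes F: "weakly_convex_on (- c) S F" and c: "0 < c" and a: "a \<in> S" and y: "y \<in> S"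
    and m: "\<And>z. z \<in> cball a 1 \<inter> S \<Longrightarrow> m \<le> F z"
    and far: "1 + 2 * (F a - m) / c < dist a y"
  shows "F a \<le> F y"
proof -
  define r where "r = norm (y - a)"
  have far_r: "2 * (F a - m) / c \<le> r - 1"
    using far by (simp add: r_def dist_norm norm_minus_commute)
  have "m \<le> F a" using m[of a] a by simp
  then have r: "1 \<le> r"
    using far_r c by (smt (verit) divide_nonneg_pos)
  define z where "z = (1 - 1 / r) *\<^sub>R a + (1 / r) *\<^sub>R y"
  have "norm (z - a) = norm ((1 / r) *\<^sub>R (y - a))"
    by (simp add: z_def algebra_simps)
  also have "\<dots> = 1" using r by (auto simp: r_def)
  finally have "z \<in> cball a 1" by (simp add: dist_norm norm_minus_commute)
  moreover have "z \<in> S"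
    unfolding z_def using r by (intro convexD_alt[OF weakly_convex_on_imp_convex[OF F] a y]) auto
  ultimately have "m \<le> F z" using m by blast
  also have "\<dots> \<le> (1 - 1 / r) * F a + 1 / r * F y - c / 2 * (1 / r * (1 - 1 / r) * r\<^sup>2)"
    using weakly_convex_onD[OF F a y, of "1 / r"] r unfolding z_def r_def[symmetric] by simp
  also have "\<dots> = F a + (F y - F a - r * (c / 2 * (r - 1))) / r"
    using r by (simp add: field_simps power2_eq_square)
  finally have "r * (c / 2 * (r - 1) - (F a - m)) \<le> F y - F a"
    using r by (simp add: field_simps)
  moreover have "0 \<le> r * (c / 2 * (r - 1) - (F a - m))"
    using far_r r c by (intro mult_nonneg_nonneg) (simp_all add: field_simps)
  ultimately show ?thesis by linarith
qed

lemma strongly_convex_attains_min: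
  fixes F :: "'v::euclidean_space \<Rightarrow> real"
  assumes S: "closed S" "S \<noteq> {}" and F: "weakly_convex_on (- c) S F" "continuous_on S F" and c: "0 < c"
  obtains p where "p \<in> S" "\<And>y. y \<in> S \<Longrightarrow> F p \<le> F y"
proof -
  obtain a where a: "a \<in> S" using S by blast
  have "compact (cball a 1 \<inter> S)" "a \<in> cball a 1 \<inter> S"
    using S a by (auto intro: compact_Int_closed)
  then obtain m where m: "\<And>y. y \<in> cball a 1 \<inter> S \<Longrightarrow> m \<le> F y"
    using continuous_attains_inf[of "cball a 1 \<inter> S" F] continuous_on_subset[OF F(2)] by blast
  from continuous_attains_inf_coercive[OF S(1) a F(2) strongly_convex_ge_if_far[OF F(1) c a _ m]]
  show thesis using that by blast
qed

lemma strongly_convex_quadratic_growth: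
  fixes F :: "'v::real_inner \<Rightarrow> real"
  assumes F: "weakly_convex_on (- c) S F" and p: "p \<in> S" and y: "y \<in> S"
    and min: "\<And>y. y \<in> S \<Longrightarrow> F p \<le> F y"
  shows "F p + c / 2 * (norm (y - p))\<^sup>2 \<le> F y"
proof -
  have "c / 2 * (norm (y - p))\<^sup>2 \<le> F y - F p"
  proof (rule field_le_mult_one_interval)
    fix s :: real assume s: "0 < s" "s < 1"
    define t where "t = 1 - s"
    have t: "0 < t" "t < 1" using s by (auto simp: t_def)
    have "F p \<le> F ((1 - t) *\<^sub>R p + t *\<^sub>R y)"
      using t by (intro min convexD_alt[OF weakly_convex_on_imp_convex[OF F] p y]) auto
    also have "\<dots> \<le> (1 - t) * F p + t * F y + - c / 2 * (t * (1 - t) * (norm (y - p))\<^sup>2)"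
      using t by (intro weakly_convex_onD[OF F p y]) auto
    also have "\<dots> = F p + t * (F y - F p - s * (c / 2 * (norm (y - p))\<^sup>2))"
      by (simp add: t_def field_simps)
    finally have "0 \<le> t * (F y - F p - s * (c / 2 * (norm (y - p))\<^sup>2))"
      by simp
    then show "s * (c / 2 * (norm (y - p))\<^sup>2) \<le> F y - F p"
      using t by (simp add: zero_le_mult_iff)
  qed
  then show ?thesis by simp
qed

section \<open>Proximal maps and Moreau envelopes\<close>

lemma has_derivative_if_quadratic_upper_bound:
  fixes e :: "'v::real_inner \<Rightarrow> real"
  assumes upper: "\<And>x y. x \<in> S \<Longrightarrow> y \<in> S \<Longrightarrow> e x \<le> e y + v y \<bullet> (x - y) + C * (norm (x - y))\<^sup>2"
    and u: "u \<in> S" and v: "continuous (at u within S) v"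
  shows "(e has_derivative (\<lambda>h. v u \<bullet> h)) (at u within S)"
proof (rule has_derivativeI_sandwich[OF zero_less_one])
  show "bounded_linear ((\<bullet>) (v u))" by (rule bounded_linear_inner_right)
  show "((\<lambda>x. norm (v x - v u) + \<bar>C\<bar> * norm (x - u)) \<longlongrightarrow> 0) (at u within S)"
    using v by (auto intro!: tendsto_eq_intros simp: continuous_within LIM_zero_iff tendsto_norm_zero)
  fix x assume x: "x \<in> S" "x \<noteq> u"
  let ?d = "norm (x - u)"
  have "\<bar>C * ?d\<^sup>2\<bar> = \<bar>C\<bar> * ?d\<^sup>2" by (simp add: abs_mult)
  moreover have "\<bar>(v x - v u) \<bullet> (x - u)\<bar> \<le> norm (v x - v u) * ?d"
    by (rule Cauchy_Schwarz_ineq2)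
  moreover have "(v x - v u) \<bullet> (x - u) - C * ?d\<^sup>2 \<le> e x - e u - v u \<bullet> (x - u)"
    "e x - e u - v u \<bullet> (x - u) \<le> C * ?d\<^sup>2"
    using upper[OF u x(1)] upper[OF x(1) u] by (simp_all add: inner_simps norm_minus_commute)
  ultimately have "\<bar>e x - e u - v u \<bullet> (x - u)\<bar> \<le> norm (v x - v u) * ?d + \<bar>C\<bar> * ?d\<^sup>2"
    by linarith
  also have "\<dots> = (norm (v x - v u) + \<bar>C\<bar> * ?d) * ?d"
    by (simp add: algebra_simps power2_eq_square)
  finally show "norm (e x - e u - v u \<bullet> (x - u)) / ?d \<le> norm (v x - v u) + \<bar>C\<bar> * ?d"
    using x(2) by (simp add: pos_divide_le_eq)
qed

lemma grad_on_eqI: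
  fixes g :: "'v::euclidean_space \<Rightarrow> real"
  assumes S: "subspace S" and u: "u \<in> S" and v: "v \<in> S"
    and der: "(g has_derivative (\<lambda>h. v \<bullet> h)) (at u within S)"
  shows "grad_on S g u = v"
  unfolding grad_on_def
proof (rule the_equality)
  fix w assume w: "w \<in> S \<and> (g has_derivative (\<lambda>h. w \<bullet> h)) (at u within S)"
  define d where "d = w - v"
  have d: "d \<in> S" using S w v by (simp add: d_def subspace_diff)
  have line: "((\<lambda>t::real. g (u + t *\<^sub>R d)) has_derivative (\<lambda>t. a \<bullet> (t *\<^sub>R d))) (at 0)"
    if a: "(g has_derivative (\<lambda>h. a \<bullet> h)) (at u within S)" for a
  proof (rule has_derivative_in_compose[where f="\<lambda>t. u + t *\<^sub>R d" and g=g])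
    show "((\<lambda>t. u + t *\<^sub>R d) has_derivative (\<lambda>t. t *\<^sub>R d)) (at 0)"
      by (auto intro!: derivative_eq_intros)
    show "(g has_derivative (\<lambda>h. a \<bullet> h)) (at (u + 0 *\<^sub>R d) within range (\<lambda>t. u + t *\<^sub>R d))"
      using S u d by (auto intro!: has_derivative_subset[OF a] subspace_add subspace_scale)
  qed
  have "(\<lambda>t::real. w \<bullet> (t *\<^sub>R d)) = (\<lambda>t. v \<bullet> (t *\<^sub>R d))"
    using has_derivative_unique[OF line line] w der by blast
  from fun_cong[OF this, of 1] have "d \<bullet> d = 0"
    by (simp add: d_def inner_simps)
  then show "w = v" by (simp add: d_def)
qed (use v der in blast)

definition prox :: "real \<Rightarrow> 'v::real_normed_vector set \<Rightarrow> ('v \<Rightarrow> real) \<Rightarrow> 'v \<Rightarrow> 'v" where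
  "prox \<eta> S g u = arg_min_on (\<lambda>y. g y + 1 / (2 * \<eta>) * (norm (y - u))\<^sup>2) S"

locale weakly_convex_prox =
  fixes S :: "'v::euclidean_space set" and g :: "'v \<Rightarrow> real" and \<rho> \<eta> :: real
  assumes subspace: "subspace S"
    and weakly_convex: "weakly_convex_on \<rho> S g"
    and \<eta>_pos: "0 < \<eta>"
    and \<eta>_\<rho>_less_1: "\<eta> * \<rho> < 1"
begin

lemma prox_objective_strongly_convex:
  "weakly_convex_on (- (1 / \<eta> - \<rho>)) S (\<lambda>y. g y + 1 / (2 * \<eta>) * (norm (y - u))\<^sup>2)"
  using weakly_convex_on_add_quadratic[OF weakly_convex, of "1 / \<eta>" u] by (simp add: mult.commute)

lemma prox_in_S: "prox \<eta> S g u \<in> S"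
  and prox_minimal: "y \<in> S \<Longrightarrow>
    g (prox \<eta> S g u) + 1 / (2 * \<eta>) * (norm (prox \<eta> S g u - u))\<^sup>2 \<le> g y + 1 / (2 * \<eta>) * (norm (y - u))\<^sup>2"
proof -
  let ?F = "\<lambda>y. g y + 1 / (2 * \<eta>) * (norm (y - u))\<^sup>2"
  have pos: "0 < 1 / \<eta> - \<rho>"
    using \<eta>_pos \<eta>_\<rho>_less_1 by (simp add: field_simps)
  have cont: "continuous_on S ?F"
    by (intro continuous_intros weakly_convex_on_subspace_imp_continuous_on[OF subspace weakly_convex])
  have "S \<noteq> {}"
    using subspace_0[OF subspace] by blast
  then obtain p where "p \<in> S" "\<And>y. y \<in> S \<Longrightarrow> ?F p \<le> ?F y"
    using strongly_convex_attains_min[OF closed_subspace[OF subspace] _ prox_objective_strongly_convex cont pos]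
    by blast
  then have "is_arg_min ?F (\<lambda>y. y \<in> S) p"
    by (simp add: is_arg_min_linorder)
  then have "is_arg_min ?F (\<lambda>y. y \<in> S) (prox \<eta> S g u)"
    unfolding prox_def arg_min_on_def arg_min_def by (rule someI)
  then show "prox \<eta> S g u \<in> S" "y \<in> S \<Longrightarrow> ?F (prox \<eta> S g u) \<le> ?F y"
    by (simp_all add: is_arg_min_linorder)
qed

lemma prox_weak_subgradient:
  assumes y: "y \<in> S"
  shows "g (prox \<eta> S g u) + ((1 / \<eta>) *\<^sub>R (u - prox \<eta> S g u)) \<bullet> (y - prox \<eta> S g u)
    - \<rho> / 2 * (norm (y - prox \<eta> S g u))\<^sup>2 \<le> g y"
proof -
  define p where "p = prox \<eta> S g u"
  have "g p + 1 / (2 * \<eta>) * (norm (p - u))\<^sup>2 + (1 / \<eta> - \<rho>) / 2 * (norm (y - p))\<^sup>2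
      \<le> g y + 1 / (2 * \<eta>) * (norm (y - u))\<^sup>2"
    unfolding p_def
    by (rule strongly_convex_quadratic_growth[OF prox_objective_strongly_convex prox_in_S y prox_minimal])
  moreover have "1 / (2 * \<eta>) * (norm (y - u))\<^sup>2 - 1 / (2 * \<eta>) * (norm (p - u))\<^sup>2
        - (1 / \<eta> - \<rho>) / 2 * (norm (y - p))\<^sup>2
      = \<rho> / 2 * (norm (y - p))\<^sup>2 - ((1 / \<eta>) *\<^sub>R (u - p)) \<bullet> (y - p)"
    unfolding power2_norm_eq_inner
    by (simp add: inner_simps algebra_simps inner_commute diff_divide_distrib add_divide_distrib)
  ultimately show ?thesis
    unfolding p_def[symmetric] by linarith
qed

lemma prox_residual_in_wc_subdiff:
  assumes "u \<in> S"
  shows "(1 / \<eta>) *\<^sub>R (u - prox \<eta> S g u) \<in> wc_subdiff \<rho> S g (prox \<eta> S g u)"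
  using assms prox_weak_subgradient prox_in_S[of u] subspace
  by (auto simp: wc_subdiff_iff intro!: subspace_add subspace_scale subspace_diff)

lemma prox_lipschitz: "(1 / (1 - \<eta> * \<rho>))-lipschitz_on UNIV (prox \<eta> S g)"
proof (rule lipschitz_onI)
  fix x u
  define p q where "p = prox \<eta> S g x" and "q = prox \<eta> S g u"
  have "((1 / \<eta>) *\<^sub>R (x - p)) \<bullet> (q - p) + ((1 / \<eta>) *\<^sub>R (u - q)) \<bullet> (p - q) \<le> \<rho> * (norm (p - q))\<^sup>2"
    using prox_weak_subgradient[OF prox_in_S[of u], of x] prox_weak_subgradient[OF prox_in_S[of x], of u]
    unfolding p_def[symmetric] q_def[symmetric] by (simp add: norm_minus_commute)
  moreover have "((1 / \<eta>) *\<^sub>R (x - p)) \<bullet> (q - p) + ((1 / \<eta>) *\<^sub>R (u - q)) \<bullet> (p - q)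
      = ((norm (p - q))\<^sup>2 - (x - u) \<bullet> (p - q)) / \<eta>"
    unfolding power2_norm_eq_inner
    by (simp add: inner_simps inner_commute diff_divide_distrib add_divide_distrib)
  ultimately have "(norm (p - q))\<^sup>2 - (x - u) \<bullet> (p - q) \<le> \<rho> * (norm (p - q))\<^sup>2 * \<eta>"
    using \<eta>_pos by (simp add: pos_divide_le_eq)
  then have "norm (p - q) * ((1 - \<eta> * \<rho>) * norm (p - q)) \<le> norm (p - q) * norm (x - u)"
    using norm_cauchy_schwarz[of "x - u" "p - q"] by (simp add: algebra_simps power2_eq_square)
  then have "(1 - \<eta> * \<rho>) * norm (p - q) \<le> norm (x - u)"
    by (cases "p = q") (simp_all add: mult_le_cancel_left_pos)
  then show "dist p q \<le> 1 / (1 - \<eta> * \<rho>) * dist x u"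
    using \<eta>_\<rho>_less_1 by (simp add: dist_norm field_simps)
qed (use \<eta>_\<rho>_less_1 in simp)

lemma moreau_env_eq:
  "moreau_env \<eta> S g u = g (prox \<eta> S g u) + 1 / (2 * \<eta>) * (norm (prox \<eta> S g u - u))\<^sup>2"
  unfolding moreau_env_def using prox_in_S prox_minimal by (intro cInf_eq_minimum) auto

lemma moreau_env_quadratic_upper_bound:
  "moreau_env \<eta> S g x \<le> moreau_env \<eta> S g u + ((1 / \<eta>) *\<^sub>R (u - prox \<eta> S g u)) \<bullet> (x - u)
    + 1 / (2 * \<eta>) * (norm (x - u))\<^sup>2"
proof -
  define p where "p = prox \<eta> S g u"
  have "moreau_env \<eta> S g x \<le> g p + 1 / (2 * \<eta>) * (norm (p - x))\<^sup>2"
    unfolding moreau_env_eq p_def by (rule prox_minimal[OF prox_in_S])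
  also have "\<dots> = g p + 1 / (2 * \<eta>) * (norm (p - u))\<^sup>2 + ((1 / \<eta>) *\<^sub>R (u - p)) \<bullet> (x - u)
      + 1 / (2 * \<eta>) * (norm (x - u))\<^sup>2"
    unfolding power2_norm_eq_inner
    by (simp add: inner_simps algebra_simps inner_commute diff_divide_distrib add_divide_distrib)
  finally show ?thesis
    by (simp add: moreau_env_eq[of u] p_def)
qed

lemma moreau_env_has_derivative:
  "(moreau_env \<eta> S g has_derivative (\<lambda>h. ((1 / \<eta>) *\<^sub>R (u - prox \<eta> S g u)) \<bullet> h)) (at u)"
proof (rule has_derivative_if_quadratic_upper_bound[OF moreau_env_quadratic_upper_bound UNIV_I])
  have "continuous (at u) (prox \<eta> S g)"
    by (rule lipschitz_on_continuous_within[OF prox_lipschitz]) simp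
  then show "continuous (at u) (\<lambda>u. (1 / \<eta>) *\<^sub>R (u - prox \<eta> S g u))"
    by (intro continuous_intros)
qed

lemma grad_on_moreau_env:
  assumes u: "u \<in> S"
  shows "grad_on S (moreau_env \<eta> S g) u = (1 / \<eta>) *\<^sub>R (u - prox \<eta> S g u)"
  using subspace u prox_in_S
  by (intro grad_on_eqI has_derivative_at_withinI[OF moreau_env_has_derivative])
    (auto intro: subspace_scale subspace_diff)

end

section \<open>Inexact fixed-point iterations\<close>

lemma tendsto_zero_if_perturbed_geometric:
  fixes e d :: "nat \<Rightarrow> real"
  assumes q: "0 \<le> q" "q < 1" and e: "\<And>k. 0 \<le> e k" "\<And>k. e (Suc k) \<le> q * e k + d k"
    and d: "d \<longlonglongrightarrow> 0"
  shows "e \<longlonglongrightarrow> 0"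
proof (rule order_tendstoI)
  fix r :: real assume r: "0 < r"
  then have "0 < (1 - q) * (r / 2)" using q by simp
  then obtain N where N: "\<And>k. N \<le> k \<Longrightarrow> d k < (1 - q) * (r / 2)"
    using order_tendstoD(2)[OF d] unfolding eventually_sequentially by blast
  have geometric: "e (m + N) \<le> r / 2 + q ^ m * e N" for m
  proof (induction m)
    case 0
    then show ?case using r by simp
  next
    case (Suc m)
    have "e (Suc m + N) \<le> q * e (m + N) + (1 - q) * (r / 2)"
      using e(2)[of "m + N"] N[of "m + N"] by simp
    also have "\<dots> \<le> q * (r / 2 + q ^ m * e N) + (1 - q) * (r / 2)"
      using Suc q by (intro add_right_mono mult_left_mono)
    finally show ?case by (simp add: field_simps)
  qed
  have "(\<lambda>m. q ^ m * e N) \<longlonglongrightarrow> 0"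
    using q by (intro tendsto_mult_left_zero LIMSEQ_power_zero) auto
  then have "eventually (\<lambda>m. q ^ m * e N < r / 2) sequentially"
    using r by (intro order_tendstoD(2)) auto
  then have "eventually (\<lambda>m. e (m + N) < r) sequentially"
    by eventually_elim (use geometric in \<open>smt (verit) field_sum_of_halves\<close>)
  then show "eventually (\<lambda>k. e k < r) sequentially"
    by (subst (asm) eventually_sequentially_seg)
qed (use e(1) in \<open>simp add: less_le_trans\<close>)

lemma norm_star_eq_norm_vec: "norm_star x = norm (\<chi> i. x i)"
  by (simp add: norm_star_def norm_vec_def L2_set_def)

lemma norm_le_norm_star: "norm (x i) \<le> norm_star x"
  using Finite_Cartesian_Product.norm_nth_le[of "\<chi> i. x i" i] by (simp add: norm_star_eq_norm_vec)

lemma norm_star_triangle_ineq: "norm_star (\<lambda>i. x i + y i) \<le> norm_star x + norm_star y"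
  using norm_triangle_ineq[of "\<chi> i. x i" "\<chi> i. y i"]
  by (simp add: norm_star_eq_norm_vec plus_vec_def)

lemma tendsto_norm_star_zero_iff:
  fixes x :: "'a \<Rightarrow> 'p::finite \<Rightarrow> 'v::real_normed_vector"
  shows "((\<lambda>k. norm_star (x k)) \<longlongrightarrow> 0) F \<longleftrightarrow> (\<forall>i. ((\<lambda>k. x k i) \<longlongrightarrow> 0) F)"
proof
  assume "((\<lambda>k. norm_star (x k)) \<longlongrightarrow> 0) F"
  then show "\<forall>i. ((\<lambda>k. x k i) \<longlongrightarrow> 0) F"
    by (auto intro: Lim_null_comparison[rotated] always_eventually norm_le_norm_star)
next
  assume "\<forall>i. ((\<lambda>k. x k i) \<longlongrightarrow> 0) F"
  then have "((\<lambda>k. norm_star (x k)) \<longlongrightarrow> sqrt (\<Sum>i\<in>(UNIV :: 'p set). (norm (0::'v))\<^sup>2)) F"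
    unfolding norm_star_def by (intro tendsto_intros) auto
  then show "((\<lambda>k. norm_star (x k)) \<longlongrightarrow> 0) F" by simp
qed

locale profile_contraction =
  fixes X :: "'p::finite \<Rightarrow> 'v::banach set" and T :: "('p \<Rightarrow> 'v) \<Rightarrow> 'p \<Rightarrow> 'v" and q :: real
  assumes X_closed: "closed (X i)"
    and X_nonempty: "X i \<noteq> {}"
    and T_in_profiles: "x \<in> profiles X \<Longrightarrow> T x \<in> profiles X"
    and q_nonneg: "0 \<le> q"
    and q_less_1: "q < 1"
    and T_contraction: "\<lbrakk>x \<in> profiles X; y \<in> profiles X\<rbrakk> \<Longrightarrow>
      norm_star (\<lambda>i. T x i - T y i) \<le> q * norm_star (\<lambda>i. x i - y i)"
begin

lemma ex1_fixed_point: "\<exists>!x. x \<in> profiles X \<and> T x = x"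
proof -
  let ?C = "{v :: 'v^'p. ($) v \<in> profiles X}" and ?T = "\<lambda>v. \<chi> i. T (($) v) i"
  have "closed ?C"
    unfolding profiles_def mem_Collect_eq using X_closed
    by (intro closed_Collect_all closed_vimage_vec_nth[unfolded vimage_def]) auto
  moreover have "(\<chi> i. SOME z. z \<in> X i) \<in> ?C"
    using X_nonempty by (auto simp: profiles_def some_in_eq)
  moreover have "dist (?T v) (?T w) \<le> q * dist v w" if "v \<in> ?C" "w \<in> ?C" for v w
    using T_contraction[of "($) v" "($) w"] that
    by (simp add: dist_norm norm_star_eq_norm_vec minus_vec_def)
  moreover have "?T ` ?C \<subseteq> ?C"
    using T_in_profiles by (auto simp: profiles_def)
  ultimately have "\<exists>!v\<in>?C. ?T v = v"
    by (intro Banach_fix[OF _ _ q_nonneg q_less_1]) (auto simp: complete_eq_closed)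
  then obtain v where v: "v \<in> ?C" "?T v = v" and uniq: "\<And>w. w \<in> ?C \<Longrightarrow> ?T w = w \<Longrightarrow> w = v"
    by blast
  show ?thesis
  proof (intro ex1I conjI)
    show "($) v \<in> profiles X" using v(1) by simp
    show "T (($) v) = ($) v" using v(2) by (simp add: vec_eq_iff fun_eq_iff)
    show "x = ($) v" if "x \<in> profiles X \<and> T x = x" for x
      using uniq[of "\<chi> i. x i"] that by (auto simp: vec_lambda_inverse)
  qed
qed

lemma continuous_on_T: "continuous_on (profiles X) (\<lambda>x. T x i)"
  unfolding continuous_on_def
proof
  fix x assume x: "x \<in> profiles X"
  let ?F = "at x within profiles X"
  have "continuous_on (profiles X) (\<lambda>y. y i)" for i
    by (rule continuous_on_subset[OF continuous_on_product_coordinates subset_UNIV])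
  then have "((\<lambda>y. y i - x i) \<longlongrightarrow> 0) ?F" for i
    using x by (intro LIM_zero) (auto simp: continuous_on_def)
  then have "((\<lambda>y. q * norm_star (\<lambda>i. y i - x i)) \<longlongrightarrow> 0) ?F"
    by (intro tendsto_mult_right_zero) (simp add: tendsto_norm_star_zero_iff)
  moreover have "eventually (\<lambda>y. norm (norm_star (\<lambda>i. T y i - T x i)) \<le> q * norm_star (\<lambda>i. y i - x i)) ?F"
    using T_contraction[OF _ x] by (auto simp: eventually_at_filter norm_star_eq_norm_vec)
  ultimately have "((\<lambda>y. norm_star (\<lambda>i. T y i - T x i)) \<longlongrightarrow> 0) ?F"
    by (rule Lim_null_comparison[rotated])
  then show "((\<lambda>y. T y i) \<longlongrightarrow> T x i) ?F"
    by (simp add: tendsto_norm_star_zero_iff LIM_zero_iff)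
qed

lemma borel_measurable_T:
  assumes \<xi>: "\<xi> \<in> borel_measurable M" and range: "\<And>\<omega>. \<omega> \<in> space M \<Longrightarrow> \<xi> \<omega> \<in> profiles X"
  shows "(\<lambda>\<omega>. T (\<xi> \<omega>) i) \<in> borel_measurable M"
proof -
  have "\<xi> \<in> measurable M (restrict_space borel (profiles X))"
    using \<xi> range by (intro measurable_restrict_space2) auto
  then show ?thesis
    by (rule measurable_compose[OF _ borel_measurable_continuous_on_restrict[OF continuous_on_T]])
qed

lemma inexact_iteration_tendsto:
  assumes x: "\<And>k. x k \<in> profiles X" and xs: "xs \<in> profiles X" "T xs = xs"
    and error: "\<And>i. (\<lambda>k. x (Suc k) i - T (x k) i) \<longlonglongrightarrow> 0"
  shows "(\<lambda>k. x k i) \<longlonglongrightarrow> xs i"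
proof -
  have "(\<lambda>k. norm_star (\<lambda>i. x k i - xs i)) \<longlonglongrightarrow> 0"
  proof (rule tendsto_zero_if_perturbed_geometric[OF q_nonneg q_less_1])
    show "(\<lambda>k. norm_star (\<lambda>i. x (Suc k) i - T (x k) i)) \<longlonglongrightarrow> 0"
      using error by (simp add: tendsto_norm_star_zero_iff)
    fix k
    show "0 \<le> norm_star (\<lambda>i. x k i - xs i)" by (simp add: norm_star_eq_norm_vec)
    have "norm_star (\<lambda>i. x (Suc k) i - xs i)
        \<le> norm_star (\<lambda>i. T (x k) i - T xs i) + norm_star (\<lambda>i. x (Suc k) i - T (x k) i)"
      using norm_star_triangle_ineq[of "\<lambda>i. T (x k) i - T xs i" "\<lambda>i. x (Suc k) i - T (x k) i"]
      by (simp add: xs(2))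
    then show "norm_star (\<lambda>i. x (Suc k) i - xs i)
        \<le> q * norm_star (\<lambda>i. x k i - xs i) + norm_star (\<lambda>i. x (Suc k) i - T (x k) i)"
      using T_contraction[OF x[of k] xs(1)] by linarith
  qed
  then show ?thesis
    by (simp add: tendsto_norm_star_zero_iff LIM_zero_iff)
qed

end

section \<open>Conditional second moments\<close>

lemma subalgebra_vimage_algebra:
  assumes \<xi>: "\<xi> \<in> measurable M N"
  shows "subalgebra M (vimage_algebra (space M) \<xi> N)"
proof -
  have "\<xi> \<in> space M \<rightarrow> space N"
    using \<xi> by (auto dest: measurable_space)
  from sets_vimage_algebra2[OF this] show ?thesis
    using \<xi> by (auto simp: subalgebra_def measurable_sets)
qed

lemma (in sigma_finite_subalgebra) nn_integral_le_if_nn_cond_exp_le: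
  assumes [measurable]: "Y \<in> borel_measurable M" and le: "AE \<omega> in M. nn_cond_exp M F Y \<omega> \<le> c"
  shows "(\<integral>\<^sup>+\<omega>. Y \<omega> \<partial>M) \<le> c * emeasure M (space M)"
proof -
  have "(\<integral>\<^sup>+\<omega>. Y \<omega> \<partial>M) = (\<integral>\<^sup>+\<omega>. nn_cond_exp M F Y \<omega> \<partial>M)"
    using nn_cond_exp_intg[of "\<lambda>_. 1" Y] by simp
  also have "\<dots> \<le> (\<integral>\<^sup>+\<omega>. c \<partial>M)"
    by (rule nn_integral_mono_AE[OF le])
  finally show ?thesis by simp
qed

lemma AE_tendsto_zero_if_nn_integral_summable:
  fixes Y :: "nat \<Rightarrow> 'w \<Rightarrow> real"
  assumes [measurable]: "\<And>k. Y k \<in> borel_measurable M" and Y: "\<And>k \<omega>. 0 \<le> Y k \<omega>"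
    and le: "\<And>k. (\<integral>\<^sup>+\<omega>. ennreal (Y k \<omega>) \<partial>M) \<le> ennreal (c k)"
    and c: "\<And>k. 0 \<le> c k" "summable c"
  shows "AE \<omega> in M. (\<lambda>k. Y k \<omega>) \<longlonglongrightarrow> 0"
proof -
  have "(\<integral>\<^sup>+\<omega>. (\<Sum>k. ennreal (Y k \<omega>)) \<partial>M) = (\<Sum>k. \<integral>\<^sup>+\<omega>. ennreal (Y k \<omega>) \<partial>M)"
    by (rule nn_integral_suminf) measurable
  also have "\<dots> \<le> (\<Sum>k. ennreal (c k))"
    by (intro suminf_le le) auto
  also have "\<dots> = ennreal (\<Sum>k. c k)"
    by (rule suminf_ennreal2[OF c])
  finally have "(\<integral>\<^sup>+\<omega>. (\<Sum>k. ennreal (Y k \<omega>)) \<partial>M) \<noteq> \<infinity>"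
    by (auto simp: top_unique)
  then have "AE \<omega> in M. (\<Sum>k. ennreal (Y k \<omega>)) \<noteq> \<infinity>"
    by (intro nn_integral_PInf_AE) measurable
  then show ?thesis
    by eventually_elim (auto intro!: summable_LIMSEQ_zero summable_suminf_not_top Y)
qed

lemma summable_power2_if_summable_nonneg:
  fixes a :: "nat \<Rightarrow> real"
  assumes "\<And>k. 0 \<le> a k" "summable a"
  shows "summable (\<lambda>k. (a k)\<^sup>2)"
proof (rule summable_comparison_test_ev[OF _ assms(2)])
  have "eventually (\<lambda>k. a k < 1) sequentially"
    using order_tendstoD(2)[OF summable_LIMSEQ_zero[OF assms(2)], of 1] by simp
  then show "eventually (\<lambda>k. norm ((a k)\<^sup>2) \<le> a k) sequentially"
    by eventually_elim (use assms(1) in \<open>simp add: power2_eq_square mult_left_le less_imp_le\<close>)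
qed

section \<open>Smoothed equilibria of weakly convex games\<close>

lemma mult_le_MAX_mult_MAX:
  fixes a b :: "'p::finite \<Rightarrow> real"
  assumes b: "\<And>i. 0 \<le> b i" and ab: "\<And>i. 0 \<le> a i * b i"
  shows "a i * b i \<le> (MAX i. a i) * (MAX i. b i)"
proof (cases "0 \<le> (MAX i. a i)")
  case True
  then show ?thesis using b by (intro mult_mono) auto
next
  case False
  then have "a j < 0" for j by (simp add: not_le)
  then have "b j = 0" for j
    using b[of j] ab[of j] by (smt (verit) mult_neg_pos)
  then show ?thesis by simp
qed

locale weakly_convex_game =
  fixes S X :: "'p::finite \<Rightarrow> 'v::euclidean_space set"
    and f :: "'p \<Rightarrow> ('p \<Rightarrow> 'v) \<Rightarrow> real"
    and \<rho> :: "'p \<Rightarrow> real"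
    and \<eta> :: real
  assumes subspace_S: "subspace (S i)"
    and X_nonempty: "X i \<noteq> {}"
    and X_closed: "closed (X i)"
    and X_convex: "convex (X i)"
    and X_subset_S: "X i \<subseteq> S i"
    and weakly_convex_f: "x \<in> profiles S \<Longrightarrow> weakly_convex_on (\<rho> i) (S i) (\<lambda>y. f i (x(i := y)))"
    and \<eta>_pos: "0 < \<eta>"
    and \<eta>_\<rho>_less_1: "\<eta> * \<rho> i < 1"
begin

abbreviation own_cost :: "'p \<Rightarrow> ('p \<Rightarrow> 'v) \<Rightarrow> 'v \<Rightarrow> real" where
  "own_cost i x \<equiv> \<lambda>y. f i (x(i := y))"

abbreviation smoothed_grad :: "'p \<Rightarrow> ('p \<Rightarrow> 'v) \<Rightarrow> 'v" where
  "smoothed_grad i x \<equiv> pgrad S (fenv S f \<eta> i) i x"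

lemma profiles_X_subset_profiles_S: "x \<in> profiles X \<Longrightarrow> x \<in> profiles S"
  using X_subset_S by (auto simp: profiles_def)

lemma weakly_convex_prox_own_cost:
  "x \<in> profiles S \<Longrightarrow> weakly_convex_prox (S i) (own_cost i x) (\<rho> i) \<eta>"
  using subspace_S weakly_convex_f \<eta>_pos \<eta>_\<rho>_less_1 by unfold_locales

lemma smoothed_grad_eq:
  assumes x: "x \<in> profiles S"
  shows "smoothed_grad i x = (1 / \<eta>) *\<^sub>R (x i - prox \<eta> (S i) (own_cost i x) (x i))"
proof -
  interpret weakly_convex_prox "S i" "own_cost i x" "\<rho> i" \<eta>
    by (rule weakly_convex_prox_own_cost[OF x])
  show ?thesis
    using x grad_on_moreau_env[of "x i"] by (simp add: pgrad_def fenv_def profiles_def)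
qed

lemma smoothed_grad_in_S:
  assumes x: "x \<in> profiles S"
  shows "smoothed_grad i x \<in> S i"
proof -
  interpret weakly_convex_prox "S i" "own_cost i x" "\<rho> i" \<eta>
    by (rule weakly_convex_prox_own_cost[OF x])
  show ?thesis
    using x subspace prox_in_S unfolding smoothed_grad_eq[OF x]
    by (intro subspace_scale subspace_diff) (auto simp: profiles_def)
qed

lemma nearby_wc_subgradient:
  assumes x: "x \<in> profiles S"
    and lip: "setval_lipschitz_on (S i) L (wc_subdiff (\<rho> i) (S i) (own_cost i x))"
  obtains b where "b \<in> wc_subdiff (\<rho> i) (S i) (own_cost i x) (x i)"
    and "norm (smoothed_grad i x - b) \<le> \<eta> * (L * norm (smoothed_grad i x))"
proof -
  interpret weakly_convex_prox "S i" "own_cost i x" "\<rho> i" \<eta>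
    by (rule weakly_convex_prox_own_cost[OF x])
  define p where "p = prox \<eta> (S i) (own_cost i x) (x i)"
  have grad: "smoothed_grad i x = (1 / \<eta>) *\<^sub>R (x i - p)"
    unfolding p_def by (rule smoothed_grad_eq[OF x])
  have xi: "x i \<in> S i" using x by (simp add: profiles_def)
  then have "smoothed_grad i x \<in> wc_subdiff (\<rho> i) (S i) (own_cost i x) p"
    unfolding smoothed_grad_eq[OF x] p_def by (rule prox_residual_in_wc_subdiff)
  moreover have "p \<in> S i" unfolding p_def by (rule prox_in_S)
  ultimately obtain b where "b \<in> wc_subdiff (\<rho> i) (S i) (own_cost i x) (x i)"
      "norm (smoothed_grad i x - b) \<le> L * norm (p - x i)"
    using lip xi unfolding setval_lipschitz_on_def by blast
  moreover have "norm (p - x i) = \<eta> * norm (smoothed_grad i x)"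
    using \<eta>_pos by (simp add: grad norm_minus_commute)
  ultimately show thesis using that by (simp add: mult.left_commute)
qed

lemma smoothed_QNE_directional_derivative:
  assumes qne: "smoothed_QNE S X f \<eta> x" and z: "z \<in> X i"
    and lip: "setval_lipschitz_on (S i) L (wc_subdiff (\<rho> i) (S i) (own_cost i x))"
  obtains l where "((\<lambda>t. (f i (x(i := x i + t *\<^sub>R (z - x i))) - f i x) / t) \<longlongrightarrow> l) (at_right 0)"
    and "- (\<eta> * (L * norm (smoothed_grad i x)) * norm (z - x i)) \<le> l"
proof -
  have x: "x \<in> profiles X" and vi: "0 \<le> smoothed_grad i x \<bullet> (z - x i)"
    using qne z by (auto simp: smoothed_QNE_def)
  note xS = profiles_X_subset_profiles_S[OF x]
  obtain b where b: "b \<in> wc_subdiff (\<rho> i) (S i) (own_cost i x) (x i)"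
    "norm (smoothed_grad i x - b) \<le> \<eta> * (L * norm (smoothed_grad i x))"
    by (rule nearby_wc_subgradient[OF xS lip])
  have "x i \<in> S i" "x i + (z - x i) \<in> S i"
    using xS z X_subset_S by (auto simp: profiles_def)
  then obtain l where l: "((\<lambda>t. (own_cost i x (x i + t *\<^sub>R (z - x i)) - own_cost i x (x i)) / t) \<longlongrightarrow> l) (at_right 0)"
    "b \<bullet> (z - x i) \<le> l"
    by (rule weakly_convex_directional_derivative[OF weakly_convex_f[OF xS] _ _ b(1)])
  have "(smoothed_grad i x - b) \<bullet> (z - x i) \<le> norm (smoothed_grad i x - b) * norm (z - x i)"
    by (rule norm_cauchy_schwarz)
  also have "\<dots> \<le> \<eta> * (L * norm (smoothed_grad i x)) * norm (z - x i)"
    by (intro mult_right_mono b(2)) simp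
  finally have "- (\<eta> * (L * norm (smoothed_grad i x)) * norm (z - x i)) \<le> l"
    using vi l(2) by (simp add: inner_diff_left)
  with l(1) show thesis by (intro that) simp
qed

lemma smoothed_QNE_imp_eps_QNE:
  assumes qne: "smoothed_QNE S X f \<eta> x" and compact: "\<And>i. compact (X i)"
    and lip: "\<And>i. setval_lipschitz_on (S i) (L i) (wc_subdiff (\<rho> i) (S i) (own_cost i x))"
  shows "eps_QNE X f (\<eta> * (MAX i. L i) * (MAX i. diameter (X i)) * (MAX i. norm (smoothed_grad i x))) x"
  unfolding eps_QNE_def
proof (intro conjI allI ballI)
  show x: "x \<in> profiles X" using qne by (simp add: smoothed_QNE_def)
  fix i z assume z: "z \<in> X i"
  let ?D = "MAX i. diameter (X i)" and ?L = "MAX i. L i" and ?M = "MAX i. norm (smoothed_grad i x)"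
  have L_grad_nonneg: "0 \<le> L j * norm (smoothed_grad j x)" for j
  proof -
    obtain b where "norm (smoothed_grad j x - b) \<le> \<eta> * (L j * norm (smoothed_grad j x))"
      by (rule nearby_wc_subgradient[OF profiles_X_subset_profiles_S[OF x] lip])
    then have "0 \<le> \<eta> * (L j * norm (smoothed_grad j x))"
      by (rule order_trans[OF norm_ge_zero])
    then show ?thesis using \<eta>_pos by (simp add: zero_le_mult_iff[of \<eta>])
  qed
  have "x i \<in> X i" using x by (simp add: profiles_def)
  then have "norm (z - x i) \<le> diameter (X i)"
    using diameter_bounded_bound[OF compact_imp_bounded[OF compact] z] by (simp add: dist_norm)
  also have "\<dots> \<le> ?D" by simp
  finally have distance_le: "norm (z - x i) \<le> ?D" .
  have "\<eta> * (L i * norm (smoothed_grad i x)) \<le> \<eta> * (?L * ?M)"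
    using L_grad_nonneg \<eta>_pos by (intro mult_left_mono mult_le_MAX_mult_MAX) auto
  from mult_mono'[OF this distance_le]
  have "\<eta> * (L i * norm (smoothed_grad i x)) * norm (z - x i) \<le> \<eta> * (?L * ?M) * ?D"
    using L_grad_nonneg[of i] \<eta>_pos by simp
  also have "\<dots> = \<eta> * ?L * ?D * ?M" by simp
  finally have "- (\<eta> * ?L * ?D * ?M) \<le> - (\<eta> * (L i * norm (smoothed_grad i x)) * norm (z - x i))"
    by (rule le_imp_neg_le)
  moreover obtain l where "((\<lambda>t. (f i (x(i := x i + t *\<^sub>R (z - x i))) - f i x) / t) \<longlongrightarrow> l) (at_right 0)"
    "- (\<eta> * (L i * norm (smoothed_grad i x)) * norm (z - x i)) \<le> l"
    by (rule smoothed_QNE_directional_derivative[OF qne z lip])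
  ultimately show "\<exists>l. ((\<lambda>t. (f i (x(i := x i + t *\<^sub>R (z - x i))) - f i x) / t) \<longlongrightarrow> l) (at_right 0)
      \<and> - (\<eta> * ?L * ?D * ?M) \<le> l"
    using order_trans by blast
qed

end

section \<open>Best responses to the quadratic surrogates\<close>

lemma closest_point_eq_iff_inner_le:
  fixes C :: "'v::euclidean_space set"
  assumes C: "convex C" "closed C" and x: "x \<in> C"
  shows "closest_point C a = x \<longleftrightarrow> (\<forall>z\<in>C. (a - x) \<bullet> (z - x) \<le> 0)"
proof
  assume "closest_point C a = x"
  then show "\<forall>z\<in>C. (a - x) \<bullet> (z - x) \<le> 0"
    using closest_point_dot[OF C] by auto
next
  assume obtuse: "\<forall>z\<in>C. (a - x) \<bullet> (z - x) \<le> 0"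
  have "dist a x \<le> dist a z" if "z \<in> C" for z
  proof -
    have "(norm (a - z))\<^sup>2 = (norm (a - x))\<^sup>2 - 2 * ((a - x) \<bullet> (z - x)) + (norm (z - x))\<^sup>2"
      unfolding power2_norm_eq_inner by (simp add: inner_simps inner_commute)
    then have "(norm (a - x))\<^sup>2 \<le> (norm (a - z))\<^sup>2"
      using obtuse that by (smt (verit) zero_le_power2)
    then show ?thesis unfolding dist_norm by (rule power2_le_imp_le) simp
  qed
  then show "closest_point C a = x"
    using closest_point_unique[OF C x] by simp
qed

locale surrogate_game = weakly_convex_game S X f \<rho> \<eta>
  for S X :: "'p::finite \<Rightarrow> 'v::euclidean_space set" and f \<rho> \<eta> +
  fixes \<mu> :: real
  assumes \<mu>_pos: "0 < \<mu>"
begin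

abbreviation best_response :: "('p \<Rightarrow> 'v) \<Rightarrow> 'p \<Rightarrow> 'v" where
  "best_response x \<equiv> \<lambda>i. bresp S X f \<eta> \<mu> i x"

lemma grad_fhat:
  assumes y: "y \<in> profiles S" and z: "z \<in> S i"
  shows "grad_on (S i) (\<lambda>z. fhat S f \<eta> \<mu> i z y) z = smoothed_grad i y + \<mu> *\<^sub>R (z - y i)"
proof (rule grad_on_eqI[OF subspace_S z])
  show "smoothed_grad i y + \<mu> *\<^sub>R (z - y i) \<in> S i"
    using y z smoothed_grad_in_S[OF y] subspace_S
    by (intro subspace_add subspace_scale subspace_diff) (auto simp: profiles_def)
  show "((\<lambda>z. fhat S f \<eta> \<mu> i z y) has_derivative (\<bullet>) (smoothed_grad i y + \<mu> *\<^sub>R (z - y i))) (at z within S i)"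
    unfolding fhat_def power2_norm_eq_inner
    by (auto intro!: derivative_eq_intros simp: fun_eq_iff inner_simps algebra_simps inner_commute)
qed

lemma best_response_eq_closest_point:
  "best_response y i = closest_point (X i) (y i - (1 / \<mu>) *\<^sub>R smoothed_grad i y)"
proof -
  define a where "a = y i - (1 / \<mu>) *\<^sub>R smoothed_grad i y"
  have "fhat S f \<eta> \<mu> i z y
      = fenv S f \<eta> i y - 1 / (2 * \<mu>) * (norm (smoothed_grad i y))\<^sup>2 + \<mu> / 2 * (dist a z)\<^sup>2" for z
    unfolding fhat_def a_def dist_norm power2_norm_eq_inner using \<mu>_pos
    by (simp add: inner_simps field_simps inner_commute)
  then have "fhat S f \<eta> \<mu> i z y \<le> fhat S f \<eta> \<mu> i w y \<longleftrightarrow> dist a z \<le> dist a w" for z w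
    using \<mu>_pos by (simp add: mult_le_cancel_left_pos)
  then have "best_response y i = (THE z. z \<in> X i \<and> (\<forall>w\<in>X i. dist a z \<le> dist a w))"
    by (simp add: bresp_def)
  also have "\<dots> = closest_point (X i) a"
    using closest_point_exists[OF X_closed X_nonempty, of i a] X_convex X_closed
    by (intro the_equality) (auto intro!: closest_point_unique)
  finally show ?thesis by (simp add: a_def)
qed

lemma best_response_in_profiles: "best_response y \<in> profiles X"
  using X_closed X_nonempty
  by (simp add: profiles_def best_response_eq_closest_point closest_point_in_set)

lemma smoothed_QNE_iff_fixed_point:
  "smoothed_QNE S X f \<eta> x \<longleftrightarrow> x \<in> profiles X \<and> best_response x = x"
proof -
  have "best_response x i = x i \<longleftrightarrow> (\<forall>z\<in>X i. 0 \<le> smoothed_grad i x \<bullet> (z - x i))"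
    if x: "x \<in> profiles X" for i
  proof -
    have "x i \<in> X i" using x by (simp add: profiles_def)
    then have "best_response x i = x i \<longleftrightarrow>
        (\<forall>z\<in>X i. (x i - (1 / \<mu>) *\<^sub>R smoothed_grad i x - x i) \<bullet> (z - x i) \<le> 0)"
      unfolding best_response_eq_closest_point
      by (rule closest_point_eq_iff_inner_le[OF X_convex X_closed])
    then show ?thesis
      using \<mu>_pos by (simp add: zero_le_divide_iff)
  qed
  then show ?thesis by (auto simp: smoothed_QNE_def fun_eq_iff)
qed

end

section \<open>Contractive best responses and the stochastic scheme\<close>

lemma norm_minus_le_sum: "norm_minus i x \<le> (\<Sum>j\<in>UNIV - {i}. norm (x j))"
  unfolding norm_minus_def by (rule L2_set_le_sum[unfolded L2_set_def]) simp

lemma norm_minus_eq_0_iff: "norm_minus i x = 0 \<longleftrightarrow> (\<forall>j. j \<noteq> i \<longrightarrow> x j = 0)"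
  by (auto simp: norm_minus_def sum_nonneg_eq_0_iff)

lemma spectral_norm_nonneg: "0 \<le> spectral_norm A"
  unfolding spectral_norm_def by (rule onorm_pos_le) simp

lemma norm_matrix_vector_mult_le_spectral_norm: "norm (A *v x) \<le> spectral_norm A * norm x"
  unfolding spectral_norm_def by (rule onorm) simp

locale contractive_surrogate_game = surrogate_game S X f \<rho> \<eta> \<mu>
  for S X :: "'p::finite \<Rightarrow> 'v::euclidean_space set" and f \<rho> \<eta> \<mu> +
  fixes Lh Lm :: "'p \<Rightarrow> real"
  assumes surrogate_grad_lipschitz: "\<lbrakk>z \<in> X i; y \<in> profiles X; w \<in> profiles X\<rbrakk> \<Longrightarrow>
      norm (grad_on (S i) (\<lambda>z. fhat S f \<eta> \<mu> i z y) z - grad_on (S i) (\<lambda>z. fhat S f \<eta> \<mu> i z w) z)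
      \<le> Lh i * norm (y i - w i) + Lm i * norm_minus i (\<lambda>j. y j - w j)"
    and spectral_norm_less_1: "spectral_norm (Gamma2 Lh Lm \<mu>) < 1"
begin

abbreviation \<Gamma> :: "real^'p^'p" where
  "\<Gamma> \<equiv> Gamma2 Lh Lm \<mu>"

text \<open>No sign is imposed on \<open>Lm i\<close>; comparing \<open>y\<close> with \<open>w(i := y i)\<close> shows that if it is
  negative then \<open>y\<close> and \<open>w\<close> differ at most in the component \<open>i\<close>.\<close>
lemma Lm_norm_minus_le_sum:
  assumes y: "y \<in> profiles X" and w: "w \<in> profiles X"
  shows "Lm i * norm_minus i (\<lambda>j. y j - w j) \<le> Lm i * (\<Sum>j\<in>UNIV - {i}. norm (y j - w j))"
proof (cases "0 \<le> Lm i")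
  case True
  then show ?thesis by (intro mult_left_mono norm_minus_le_sum)
next
  case False
  define v where "v = w(i := y i)"
  have "v \<in> profiles X" "y i \<in> X i" using y w by (auto simp: v_def profiles_def)
  moreover have "norm_minus i (\<lambda>j. y j - v j) = norm_minus i (\<lambda>j. y j - w j)"
    by (auto simp: norm_minus_def v_def intro!: sum.cong)
  ultimately have "0 \<le> Lm i * norm_minus i (\<lambda>j. y j - w j)"
    using order_trans[OF norm_ge_zero surrogate_grad_lipschitz[of "y i" i y v]] y by (simp add: v_def)
  moreover have "0 \<le> norm_minus i (\<lambda>j. y j - w j)"
    by (simp add: norm_minus_def sum_nonneg)
  ultimately have "norm_minus i (\<lambda>j. y j - w j) = 0"
    using False by (simp add: zero_le_mult_iff)
  then have "y j = w j" if "j \<noteq> i" for j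
    using that by (simp add: norm_minus_eq_0_iff)
  then show ?thesis by (simp add: norm_minus_def)
qed

lemma norm_best_response_diff_le:
  assumes y: "y \<in> profiles X" and w: "w \<in> profiles X"
  shows "norm (best_response y i - best_response w i) \<le> (\<Gamma> *v (\<chi> j. norm (y j - w j))) $ i"
proof -
  obtain z where z: "z \<in> X i" using X_nonempty by blast
  let ?step = "\<lambda>y. y i - (1 / \<mu>) *\<^sub>R smoothed_grad i y"
  let ?grad = "\<lambda>y. grad_on (S i) (\<lambda>z. fhat S f \<eta> \<mu> i z y) z"
  have step: "?step y = z - (1 / \<mu>) *\<^sub>R ?grad y" if "y \<in> profiles X" for y
    using z X_subset_S[of i] \<mu>_pos
    by (subst grad_fhat[OF profiles_X_subset_profiles_S[OF that]]) (auto simp: algebra_simps)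
  have "norm (best_response y i - best_response w i) \<le> norm (?step y - ?step w)"
    using closest_point_lipschitz[OF X_convex X_closed X_nonempty]
    by (simp add: best_response_eq_closest_point dist_norm)
  also have "?step y - ?step w = (1 / \<mu>) *\<^sub>R (?grad w - ?grad y)"
    unfolding step[OF y] step[OF w] by (simp add: algebra_simps)
  also have "norm \<dots> = 1 / \<mu> * norm (?grad y - ?grad w)"
    using \<mu>_pos by (simp add: norm_minus_commute)
  also have "\<dots> \<le> 1 / \<mu> * (Lh i * norm (y i - w i) + Lm i * norm_minus i (\<lambda>j. y j - w j))"
    using \<mu>_pos surrogate_grad_lipschitz[OF z y w] by (intro mult_left_mono) auto
  also have "\<dots> \<le> 1 / \<mu> * (Lh i * norm (y i - w i) + Lm i * (\<Sum>j\<in>UNIV - {i}. norm (y j - w j)))"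
    using \<mu>_pos Lm_norm_minus_le_sum[OF y w, of i] by (intro mult_left_mono) auto
  also have "\<dots> = (\<Gamma> *v (\<chi> j. norm (y j - w j))) $ i"
    by (simp add: matrix_vector_mult_def Gamma2_def sum.remove[of UNIV i] sum_distrib_left
        add_divide_distrib sum_divide_distrib)
  finally show ?thesis .
qed

lemma norm_star_best_response_diff_le:
  assumes y: "y \<in> profiles X" and w: "w \<in> profiles X"
  shows "norm_star (\<lambda>i. best_response y i - best_response w i) \<le> spectral_norm \<Gamma> * norm_star (\<lambda>i. y i - w i)"
proof -
  let ?v = "\<chi> j. norm (y j - w j)"
  have "norm_star (\<lambda>i. best_response y i - best_response w i)
      = norm (\<chi> i. norm (best_response y i - best_response w i))"
    by (simp add: norm_star_def norm_vec_def L2_set_def)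
  also have "\<dots> \<le> norm (\<Gamma> *v ?v)"
    using norm_best_response_diff_le[OF y w]
    by (intro norm_le_componentwise_cart) (auto intro: order_trans[OF _ abs_ge_self])
  also have "\<dots> \<le> spectral_norm \<Gamma> * norm ?v"
    by (rule norm_matrix_vector_mult_le_spectral_norm)
  also have "norm ?v = norm_star (\<lambda>i. y i - w i)"
    by (simp add: norm_star_def norm_vec_def L2_set_def)
  finally show ?thesis .
qed

sublocale contraction: profile_contraction X best_response "spectral_norm \<Gamma>"
  using X_closed X_nonempty best_response_in_profiles spectral_norm_nonneg spectral_norm_less_1
    norm_star_best_response_diff_le by unfold_locales

context
  fixes M :: "'w measure" and \<epsilon> :: "'p \<Rightarrow> nat \<Rightarrow> real" and xk :: "nat \<Rightarrow> 'w \<Rightarrow> 'p \<Rightarrow> 'v"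
  assumes prob_space_M: "prob_space M" and scheme: "ms_ssbr M S X f \<eta> \<mu> \<epsilon> xk"
begin

text \<open>Without measurability the conditional bound would be void: \<^const>\<open>nn_cond_exp\<close> returns \<open>0\<close> on
  non-measurable integrands.\<close>
lemma ms_ssbr_error_measurable:
  "(\<lambda>\<omega>. xk (Suc k) \<omega> i - best_response (xk k \<omega>) i) \<in> borel_measurable M"
proof -
  have meas: "xk k \<in> borel_measurable M" for k
    using scheme by (simp add: ms_ssbr_def)
  have "(\<lambda>\<omega>. xk (Suc k) \<omega> i) \<in> borel_measurable M"
    by (rule measurable_compose[OF meas borel_measurable_continuous_onI[OF continuous_on_product_coordinates]])
  moreover have "(\<lambda>\<omega>. best_response (xk k \<omega>) i) \<in> borel_measurable M"
    using meas scheme by (intro contraction.borel_measurable_T) (auto simp: ms_ssbr_def)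
  ultimately show ?thesis by (rule borel_measurable_diff)
qed

lemma ms_ssbr_error_second_moment_le:
  "(\<integral>\<^sup>+\<omega>. ennreal ((norm (xk (Suc k) \<omega> i - best_response (xk k \<omega>) i))\<^sup>2) \<partial>M) \<le> ennreal ((\<epsilon> i k)\<^sup>2)"
proof -
  interpret prob_space M by (rule prob_space_M)
  let ?F = "vimage_algebra (space M) (xk k) borel"
  have "subalgebra M ?F"
    using scheme by (intro subalgebra_vimage_algebra) (simp add: ms_ssbr_def)
  then interpret finite_measure_subalgebra M ?F
    by unfold_locales
  have "(\<lambda>\<omega>. ennreal ((norm (xk (Suc k) \<omega> i - best_response (xk k \<omega>) i))\<^sup>2)) \<in> borel_measurable M"
    using ms_ssbr_error_measurable by measurable
  from nn_integral_le_if_nn_cond_exp_le[OF this] show ?thesis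
    using scheme by (simp add: ms_ssbr_def emeasure_space_1)
qed

lemma ms_ssbr_error_AE_tendsto_zero:
  assumes \<epsilon>: "\<And>k. 0 \<le> \<epsilon> i k" "summable (\<epsilon> i)"
  shows "AE \<omega> in M. (\<lambda>k. xk (Suc k) \<omega> i - best_response (xk k \<omega>) i) \<longlonglongrightarrow> 0"
proof -
  note ms_ssbr_error_measurable[measurable]
  have "AE \<omega> in M. (\<lambda>k. (norm (xk (Suc k) \<omega> i - best_response (xk k \<omega>) i))\<^sup>2) \<longlonglongrightarrow> 0"
    using ms_ssbr_error_second_moment_le summable_power2_if_summable_nonneg[OF \<epsilon>]
    by (intro AE_tendsto_zero_if_nn_integral_summable[where c = "\<lambda>k. (\<epsilon> i k)\<^sup>2"]) auto
  then show ?thesis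
    by (simp add: power_tendsto_0_iff tendsto_norm_zero_iff)
qed

lemma ms_ssbr_AE_tendsto:
  assumes \<epsilon>: "\<And>i k. 0 \<le> \<epsilon> i k" "\<And>i. summable (\<epsilon> i)"
    and xs: "xs \<in> profiles X" "best_response xs = xs"
  shows "AE \<omega> in M. \<forall>i. (\<lambda>k. xk k \<omega> i) \<longlonglongrightarrow> xs i"
proof -
  have "AE \<omega> in M. \<forall>i. (\<lambda>k. xk (Suc k) \<omega> i - best_response (xk k \<omega>) i) \<longlonglongrightarrow> 0"
    using ms_ssbr_error_AE_tendsto_zero[OF \<epsilon>] by (simp add: AE_all_countable)
  then show ?thesis
    using AE_space
  proof eventually_elim
    case (elim \<omega>)
    then show ?case
      using contraction.inexact_iteration_tendsto[OF _ xs, of "\<lambda>k. xk k \<omega>"] scheme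
      by (simp add: ms_ssbr_def)
  qed
qed

end

end

theorem theorem4p3:
  fixes S :: "'p::finite \<Rightarrow> 'v::euclidean_space set"
    and X :: "'p \<Rightarrow> 'v set"
    and f :: "'p \<Rightarrow> ('p \<Rightarrow> 'v) \<Rightarrow> real"
    and \<rho> Lh Lm :: "'p \<Rightarrow> real"
    and \<eta> \<mu> :: real
  assumes S: "\<And>i. subspace (S i)"
    and X: "\<And>i. X i \<noteq> {} \<and> closed (X i) \<and> convex (X i) \<and> X i \<subseteq> S i"
    and wc: "\<And>i x. x \<in> profiles S \<Longrightarrow> weakly_convex_on (\<rho> i) (S i) (\<lambda>y. f i (x(i := y)))"
    and rho_pos: "\<And>i. \<rho> i > 0"
    and eta: "\<eta> > 0" "\<And>i. \<eta> < 1 / \<rho> i"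
    and mu: "\<mu> > 0"
    and C1: "\<And>i xi y w. xi \<in> X i \<Longrightarrow> y \<in> profiles X \<Longrightarrow> w \<in> profiles X \<Longrightarrow>
               norm (grad_on (S i) (\<lambda>z. fhat S f \<eta> \<mu> i z y) xi
                     - grad_on (S i) (\<lambda>z. fhat S f \<eta> \<mu> i z w) xi)
               \<le> Lh i * norm (y i - w i) + Lm i * norm_minus i (\<lambda>j. y j - w j)"
    and C2: "spectral_norm (Gamma2 Lh Lm \<mu>) < 1"
  shows
    "(\<forall>y \<in> profiles X. \<forall>w \<in> profiles X. \<forall>i.
        norm (bresp S X f \<eta> \<mu> i y - bresp S X f \<eta> \<mu> i w)
        \<le> (Gamma2 Lh Lm \<mu> *v (\<chi> j. norm (y j - w j))) $ i)
     \<and> (\<forall>y \<in> profiles X. (\<lambda>i. bresp S X f \<eta> \<mu> i y) \<in> profiles X)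
     \<and> (\<exists>q. 0 \<le> q \<and> q < 1 \<and> (\<forall>y \<in> profiles X. \<forall>w \<in> profiles X.
          norm_star (\<lambda>i. bresp S X f \<eta> \<mu> i y - bresp S X f \<eta> \<mu> i w)
          \<le> q * norm_star (\<lambda>i. y i - w i)))
     \<and> (\<exists>xs \<in> profiles X.
          (\<lambda>i. bresp S X f \<eta> \<mu> i xs) = xs
        \<and> (\<forall>x \<in> profiles X. (\<lambda>i. bresp S X f \<eta> \<mu> i x) = x \<longrightarrow> x = xs)
        \<and> (\<forall>x. smoothed_QNE S X f \<eta> x \<longleftrightarrow> x = xs)
        \<and> (\<forall>L :: 'p \<Rightarrow> real.
             (\<forall>i. compact (X i)) \<and>
             (\<forall>i. \<forall>x \<in> profiles S. setval_lipschitz_on (S i) (L i)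
                     (wc_subdiff (\<rho> i) (S i) (\<lambda>y. f i (x(i := y)))))
             \<longrightarrow> eps_QNE X f
                   (\<eta> * (MAX i. L i) * (MAX i. diameter (X i))
                      * (MAX i. norm (pgrad S (fenv S f \<eta> i) i xs))) xs)
        \<and> (\<forall>(M :: 'w measure) (\<epsilon> :: 'p \<Rightarrow> nat \<Rightarrow> real) xk.
             prob_space M \<and> (\<forall>i k. \<epsilon> i k \<ge> 0) \<and> (\<forall>i. summable (\<epsilon> i)) \<and>
             ms_ssbr M S X f \<eta> \<mu> \<epsilon> xk
             \<longrightarrow> (AE \<omega> in M. \<forall>i. (\<lambda>k. xk k \<omega> i) \<longlonglongrightarrow> xs i)))"
proof -
  interpret contractive_surrogate_game S X f \<rho> \<eta> \<mu> Lh Lm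
    using assms by unfold_locales (auto simp: field_simps)
  obtain xs where xs: "xs \<in> profiles X" "best_response xs = xs"
    and unique: "\<And>x. x \<in> profiles X \<Longrightarrow> best_response x = x \<Longrightarrow> x = xs"
    using contraction.ex1_fixed_point by blast
  have qne: "smoothed_QNE S X f \<eta> x \<longleftrightarrow> x = xs" for x
    using xs unique smoothed_QNE_iff_fixed_point by blast
  show ?thesis
  proof (intro conjI exI[of _ "spectral_norm \<Gamma>"] bexI[OF _ xs(1)] ballI allI impI)
    fix L :: "'p \<Rightarrow> real"
    assume "(\<forall>i. compact (X i)) \<and> (\<forall>i. \<forall>x \<in> profiles S.
      setval_lipschitz_on (S i) (L i) (wc_subdiff (\<rho> i) (S i) (own_cost i x)))"
    then show "eps_QNE X f (\<eta> * (MAX i. L i) * (MAX i. diameter (X i))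
        * (MAX i. norm (smoothed_grad i xs))) xs"
      using qne profiles_X_subset_profiles_S[OF xs(1)] by (intro smoothed_QNE_imp_eps_QNE) auto
  next
    fix M :: "'w measure" and \<epsilon> xk
    assume "prob_space M \<and> (\<forall>i k. \<epsilon> i k \<ge> 0) \<and> (\<forall>i. summable (\<epsilon> i)) \<and> ms_ssbr M S X f \<eta> \<mu> \<epsilon> xk"
    then show "AE \<omega> in M. \<forall>i. (\<lambda>k. xk k \<omega> i) \<longlonglongrightarrow> xs i"
      using xs by (intro ms_ssbr_AE_tendsto[of M \<epsilon>]) auto
  qed (rule norm_best_response_diff_le best_response_in_profiles spectral_norm_nonneg
      spectral_norm_less_1 norm_star_best_response_diff_le xs(2) unique qne; assumption)+
qed

end
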